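(* For every integer $n\geq 3$, the poset $(P\!E_{n},\leq_{\mathrm{dref}})$ is a supersolvable lattice.
   Context: Write $[n]=\{1,\dots,n\}$. A set partition $\mathbf{x}$ of $[n]$ is noncrossing if for all $1\leq i<j<k<l\leq n$, whenever $i,k$ lie in a common block and $j,l$ lie in a common block, then $i,j$ lie in a common block; write $i\sim_{\mathbf{x}}j$ if $i,j$ lie in the same block. $NC_{n}$ is the set of noncrossing set partitions of $[n]$, and $\leq_{\mathrm{dref}}$ (dual refinement) is defined by $\mathbf{x}\leq_{\mathrm{dref}}\mathbf{y}$ iff every block of $\mathbf{x}$ is contained in a block of $\mathbf{y}$. For $n\geq 3$, $P\!E_{n}$ is the set of all $\mathbf{x}\in NC_{n}$ such that $\{n-1,n\}$ is not a block of $\mathbf{x}$, and it is not the case that both $1\sim_{\mathbf{x}}n-1$ and $\{n\}$ is a block of $\mathbf{x}$. $(P\!E_{n},\leq_{\mathrm{dref}})$ is the induced subposet of $(NC_{n},\leq_{\mathrm{dref}})$ on $P\!E_{n}$. A finite lattice is supersolvable if it contains a maximal chain $M$ such that for every chain $C$ of the lattice the sublattice generated by $M$ and $C$ (the smallest sublattice containing $M\cup C$) is distributive. *)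

theory Defs
  imports "HOL-Library.Disjoint_Sets" "HOL-Algebra.Lattice"
begin

text \<open>
  Orders and lattices are those of \<^theory>\<open>HOL-Algebra.Lattice\<close>: the ground set is
  \<open>carrier L\<close>, and \<open>lattice L\<close> includes that the order is antisymmetric with respect to
  equality.
\<close>

definition sublattice :: "('a, 'b) gorder_scheme \<Rightarrow> 'a set \<Rightarrow> bool" where
  "sublattice L S \<longleftrightarrow> S \<subseteq> carrier L \<and>
     (\<forall>x\<in>S. \<forall>y\<in>S. x \<squnion>\<^bsub>L\<^esub> y \<in> S \<and> x \<sqinter>\<^bsub>L\<^esub> y \<in> S)"

definition generated_sublattice :: "('a, 'b) gorder_scheme \<Rightarrow> 'a set \<Rightarrow> 'a set" where
  "generated_sublattice L X = \<Inter>{S. sublattice L S \<and> X \<subseteq> S}"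

definition distributive_lattice :: "('a, 'b) gorder_scheme \<Rightarrow> bool" where
  "distributive_lattice L \<longleftrightarrow> lattice L \<and>
     (\<forall>x\<in>carrier L. \<forall>y\<in>carrier L. \<forall>z\<in>carrier L.
        x \<sqinter>\<^bsub>L\<^esub> (y \<squnion>\<^bsub>L\<^esub> z) = (x \<sqinter>\<^bsub>L\<^esub> y) \<squnion>\<^bsub>L\<^esub> (x \<sqinter>\<^bsub>L\<^esub> z))"

text \<open>
  \<open>pred_on.chain A P\<close> and \<open>pred_on.maxchain A P\<close> compare elements by the reflexive closure
  of \<open>P\<close>, so it is immaterial that \<open>le L\<close> is already reflexive on the carrier.
\<close>

definition supersolvable_lattice :: "('a, 'b) gorder_scheme \<Rightarrow> bool" where
  "supersolvable_lattice L \<longleftrightarrow> lattice L \<and> finite (carrier L) \<and>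
     (\<exists>M. pred_on.maxchain (carrier L) (le L) M \<and>
        (\<forall>C. pred_on.chain (carrier L) (le L) C \<longrightarrow>
           distributive_lattice (L\<lparr>carrier := generated_sublattice L (M \<union> C)\<rparr>)))"

definition same_block :: "'a set set \<Rightarrow> 'a \<Rightarrow> 'a \<Rightarrow> bool" where
  "same_block x i j \<longleftrightarrow> (\<exists>B\<in>x. i \<in> B \<and> j \<in> B)"

definition NC :: "nat \<Rightarrow> nat set set set" where
  "NC n = {x. partition_on {1..n} x \<and>
     (\<forall>i j k l. 1 \<le> i \<and> i < j \<and> j < k \<and> k < l \<and> l \<le> n \<and>
        same_block x i k \<and> same_block x j l \<longrightarrow> same_block x i j)}"

definition PE :: "nat \<Rightarrow> nat set set set" where
  "PE n = {x \<in> NC n. {n - 1, n} \<notin> x \<and> \<not> (same_block x 1 (n - 1) \<and> {n} \<in> x)}"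

text \<open>
  Dual refinement: \<^term>\<open>refines A x y\<close> says that \<open>x\<close> and \<open>y\<close> are partitions of \<open>A\<close> and every
  block of \<open>x\<close> is contained in a block of \<open>y\<close>, so finer partitions are smaller.
\<close>

definition NC_poset :: "nat \<Rightarrow> nat set set gorder" where
  "NC_poset n = \<lparr>carrier = NC n, eq = (=), le = refines {1..n}\<rparr>"

definition PE_poset :: "nat \<Rightarrow> nat set set gorder" where
  "PE_poset n = NC_poset n\<lparr>carrier := PE n\<rparr>"

end

(*
  Rotate the labels so that n comes before 1. Let M consist of the partitions with the single
  possibly nontrivial block {n, 1, ..., i}, and let D x be the set of elements which are not minimal
  in their block of x. For x below y, D x is a subset of D y, with equality only if x = y. Meets and
  joins of an arbitrary x with some c in M are computed as for noncrossing partitions, whence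
  D (x meet c) = D x Int D c and D (x join c) = D x Un D c. This forces the sublattice generated by
  M and any chain C to be embedded by D in a powerset.
*)

theory Submission
  imports Defs "HOL-Algebra.Complete_Lattice"
begin

text \<open>The rotation is dictated by the two exclusions. The obvious chain of blocks
  \<open>{1..i}\<close> passes through \<open>{1..n - 1}\<close> with \<open>{n}\<close> alone, and
  a chain growing down from \<open>n\<close> passes through the block \<open>{n - 1, n}\<close>;
  neither stays inside \<open>PE n\<close>. With \<open>n\<close> first, every large block contains
  \<open>n\<close>, and \<open>n - 1\<close> enters last, when \<open>1\<close> is already present.
  On arbitrary pairs \<open>D\<close> does not respect meets: for \<open>n = 4\<close> the
  partitions with blocks \<open>{1, 3, 4}, {2}\<close> and \<open>{1}, {2, 3, 4}\<close> both have
  \<open>3\<close> in \<open>D\<close>, but they meet in the all-singleton partition, since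
  \<open>{3, 4}\<close> is not an admissible block. The two identities are therefore asked only when
  one argument lies in \<open>M\<close>. Together with strictness they make each member of
  \<open>M\<close> left modular, and the chain condition on \<open>C\<close> then suffices to
  recover both homomorphism laws on the generated sublattice.\<close>

section \<open>A distributivity criterion for sublattices generated by two chains\<close>

lemma (in lattice) sublattice_lattice:
  assumes "sublattice L S"
  shows "lattice (L\<lparr>carrier := S\<rparr>)"
    and "\<And>x y. \<lbrakk>x \<in> S; y \<in> S\<rbrakk> \<Longrightarrow> x \<squnion>\<^bsub>L\<lparr>carrier := S\<rparr>\<^esub> y = x \<squnion> y"
    and "\<And>x y. \<lbrakk>x \<in> S; y \<in> S\<rbrakk> \<Longrightarrow> x \<sqinter>\<^bsub>L\<lparr>carrier := S\<rparr>\<^esub> y = x \<sqinter> y"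
proof -
  let ?K = "L\<lparr>carrier := S\<rparr>"
  have sub: "S \<subseteq> carrier L"
    and closed: "\<And>x y. \<lbrakk>x \<in> S; y \<in> S\<rbrakk> \<Longrightarrow> x \<squnion> y \<in> S \<and> x \<sqinter> y \<in> S"
    using assms by (auto simp: sublattice_def)
  interpret K: weak_partial_order ?K
    using weak_partial_order_subset[OF _ sub] weak_partial_order_axioms by blast
  interpret K: partial_order ?K
    by unfold_locales (simp add: eq_is_equal)
  \<comment> \<open>The operations of the restricted structure pick extremal bounds inside
    \<open>S\<close>. Closure puts the ambient join and meet there, and they stay extremal among
    fewer competitors.\<close>
  have lub: "least ?K (x \<squnion> y) (Upper ?K {x, y})" if "x \<in> S" "y \<in> S" for x y
    using that closed[OF that] sub
    by (auto simp: least_def Upper_def subset_eq intro: join_left join_right join_le)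
  have glb: "greatest ?K (x \<sqinter> y) (Lower ?K {x, y})" if "x \<in> S" "y \<in> S" for x y
    using that closed[OF that] sub
    by (auto simp: greatest_def Lower_def subset_eq intro: meet_left meet_right meet_le)
  show K: "lattice ?K"
  proof unfold_locales
    fix x y assume "x \<in> carrier ?K" "y \<in> carrier ?K"
    then have "x \<in> S" "y \<in> S" by simp_all
    then show "\<exists>s. is_lub ?K s {x, y}" "\<exists>s. is_glb ?K s {x, y}"
      using lub glb by blast+
  qed
  interpret K: lattice ?K by (rule K)
  show "x \<squnion>\<^bsub>?K\<^esub> y = x \<squnion> y" if "x \<in> S" "y \<in> S" for x y
  proof (rule K.joinI[where P = "\<lambda>z. z = x \<squnion> y"])
    fix z assume "is_lub ?K z {x, y}"
    then show "z = x \<squnion> y" using lub[OF that] by (rule K.least_unique)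
  qed (use that in simp_all)
  show "x \<sqinter>\<^bsub>?K\<^esub> y = x \<sqinter> y" if "x \<in> S" "y \<in> S" for x y
  proof (rule K.meetI[where P = "\<lambda>z. z = x \<sqinter> y"])
    fix z assume "is_glb ?K z {x, y}"
    then show "z = x \<sqinter> y" using glb[OF that] by (rule K.greatest_unique)
  qed (use that in simp_all)
qed

lemma (in lattice) distributive_sublatticeI:
  assumes "sublattice L S"
    and "\<And>x y z. \<lbrakk>x \<in> S; y \<in> S; z \<in> S\<rbrakk> \<Longrightarrow> x \<sqinter> (y \<squnion> z) = (x \<sqinter> y) \<squnion> (x \<sqinter> z)"
  shows "distributive_lattice (L\<lparr>carrier := S\<rparr>)"
  using assms sublattice_lattice[OF assms(1)]
  by (simp add: distributive_lattice_def sublattice_def)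

text \<open>The given \<open>S\<close> makes the intersected family nonempty, so the intersection
  lies in the carrier.\<close>

lemma sublattice_generated:
  assumes "sublattice L S" "X \<subseteq> S"
  shows "sublattice L (generated_sublattice L X)" "generated_sublattice L X \<subseteq> S"
  using assms unfolding sublattice_def generated_sublattice_def by blast+

lemma (in weak_partial_order) chain_iff:
  "pred_on.chain (carrier L) (\<sqsubseteq>) C \<longleftrightarrow> C \<subseteq> carrier L \<and> (\<forall>x\<in>C. \<forall>y\<in>C. x \<sqsubseteq> y \<or> y \<sqsubseteq> x)"
  unfolding pred_on.chain_def using le_refl by blast

lemma chain_insert_bot_top:
  assumes "pred_on.chain A R C" "b \<in> A" "t \<in> A"
    and "\<And>x. x \<in> A \<Longrightarrow> R b x" "\<And>x. x \<in> A \<Longrightarrow> R x t"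
  shows "pred_on.chain A R (insert b (insert t C))"
  using assms unfolding pred_on.chain_def by blast

text \<open>
  The elements \<open>a\<close> for which membership of each \<open>e\<close> in \<open>D a\<close> is witnessed by a bound
  \<open>x \<sqinter> c \<sqsubseteq> a\<close> or \<open>a \<sqsubseteq> x \<squnion> c\<close> form a sublattice on which \<open>D\<close> is an injective homomorphism
  into a powerset; this is because \<open>C\<close> and \<open>M\<close>, being chains, are closed under joins and meets.
\<close>

lemma (in lattice) distributive_generated_sublattice:
  fixes D :: "'a \<Rightarrow> 'c set"
  assumes M: "pred_on.chain (carrier L) (\<sqsubseteq>) M"
    and C: "pred_on.chain (carrier L) (\<sqsubseteq>) C"
    and bot: "b \<in> M" "\<And>x. x \<in> carrier L \<Longrightarrow> b \<sqsubseteq> x"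
    and top: "t \<in> M" "\<And>x. x \<in> carrier L \<Longrightarrow> x \<sqsubseteq> t"
    and mono: "\<And>x y. \<lbrakk>x \<in> carrier L; y \<in> carrier L; x \<sqsubseteq> y\<rbrakk> \<Longrightarrow> D x \<subseteq> D y"
    and strict: "\<And>x y. \<lbrakk>x \<in> carrier L; y \<in> carrier L; x \<sqsubseteq> y; D x = D y\<rbrakk> \<Longrightarrow> x = y"
    and D_meet: "\<And>x c. \<lbrakk>x \<in> carrier L; c \<in> M\<rbrakk> \<Longrightarrow> D x \<inter> D c \<subseteq> D (x \<sqinter> c)"
    and D_join: "\<And>x c. \<lbrakk>x \<in> carrier L; c \<in> M\<rbrakk> \<Longrightarrow> D (x \<squnion> c) \<subseteq> D x \<union> D c"
  shows "distributive_lattice (L\<lparr>carrier := generated_sublattice L (M \<union> C)\<rparr>)"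
proof -
  have McL: "M \<subseteq> carrier L"
    using M by (simp add: chain_iff)
  have Mlin: "c \<sqsubseteq> c' \<or> c' \<sqsubseteq> c" if "c \<in> M" "c' \<in> M" for c c'
    using M that by (auto simp: chain_iff)
  \<comment> \<open>The bounds are adjoined because a chain \<open>C\<close> may miss them; they
    serve as neutral partners for the members of \<open>M\<close>.\<close>
  define N where "N = insert b (insert t C)"
  have N: "pred_on.chain (carrier L) (\<sqsubseteq>) N"
    unfolding N_def using C bot top McL by (intro chain_insert_bot_top) auto
  then have NL: "N \<subseteq> carrier L"
    by (simp add: chain_iff)
  have Nlin: "x \<sqsubseteq> x' \<or> x' \<sqsubseteq> x" if "x \<in> N" "x' \<in> N" for x x'
    using N that by (auto simp: chain_iff)
  define S where "S = {a \<in> carrier L.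
    (\<forall>e\<in>D a. \<exists>x\<in>N. \<exists>c\<in>M. e \<in> D x \<inter> D c \<and> x \<sqinter> c \<sqsubseteq> a) \<and>
    (\<forall>e. e \<notin> D a \<longrightarrow> (\<exists>x\<in>N. \<exists>c\<in>M. e \<notin> D x \<union> D c \<and> a \<sqsubseteq> x \<squnion> c))}"
  have upper: "\<exists>x\<in>N. \<exists>c\<in>M. e \<notin> D x \<union> D c \<and> u \<squnion> v \<sqsubseteq> x \<squnion> c"
    if uv: "u \<in> S" "v \<in> S" and e: "e \<notin> D u \<union> D v" for u v e
  proof -
    obtain x c where xc: "x \<in> N" "c \<in> M" "e \<notin> D x \<union> D c" "u \<sqsubseteq> x \<squnion> c"
      using uv e by (auto simp: S_def)
    obtain x' c' where xc': "x' \<in> N" "c' \<in> M" "e \<notin> D x' \<union> D c'" "v \<sqsubseteq> x' \<squnion> c'"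
      using uv e by (auto simp: S_def)
    \<comment> \<open>\<open>y\<close> and \<open>d\<close> are taken from the given witnesses, so
      \<open>e\<close> stays outside \<open>D y\<close> and \<open>D d\<close> without any formula
      for \<open>D\<close> of a join.\<close>
    obtain y where y: "y \<in> N" "y \<in> {x, x'}" "x \<sqsubseteq> y" "x' \<sqsubseteq> y"
      using Nlin[OF xc(1) xc'(1)] xc xc' NL le_refl by blast
    obtain d where d: "d \<in> M" "d \<in> {c, c'}" "c \<sqsubseteq> d" "c' \<sqsubseteq> d"
      using Mlin[OF xc(2) xc'(2)] xc xc' McL le_refl by blast
    have L: "u \<in> carrier L" "v \<in> carrier L" "x \<in> carrier L" "c \<in> carrier L"
      "x' \<in> carrier L" "c' \<in> carrier L" "y \<in> carrier L" "d \<in> carrier L"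
      using uv xc xc' y d NL McL by (auto simp: S_def)
    have "x \<sqsubseteq> y \<squnion> d" "c \<sqsubseteq> y \<squnion> d" "x' \<sqsubseteq> y \<squnion> d" "c' \<sqsubseteq> y \<squnion> d"
      using L y d by (meson join_left join_right join_closed le_trans)+
    then have "x \<squnion> c \<sqsubseteq> y \<squnion> d" "x' \<squnion> c' \<sqsubseteq> y \<squnion> d"
      using L by (simp_all add: join_le)
    then have "u \<squnion> v \<sqsubseteq> y \<squnion> d"
      using L xc(4) xc'(4) by (meson join_closed join_le le_trans)
    then show ?thesis
      using y d xc(3) xc'(3) by blast
  qed
  have lower: "\<exists>x\<in>N. \<exists>c\<in>M. e \<in> D x \<inter> D c \<and> x \<sqinter> c \<sqsubseteq> u \<sqinter> v"
    if uv: "u \<in> S" "v \<in> S" and e: "e \<in> D u \<inter> D v" for u v e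
  proof -
    obtain x c where xc: "x \<in> N" "c \<in> M" "e \<in> D x \<inter> D c" "x \<sqinter> c \<sqsubseteq> u"
      using uv e by (auto simp: S_def)
    obtain x' c' where xc': "x' \<in> N" "c' \<in> M" "e \<in> D x' \<inter> D c'" "x' \<sqinter> c' \<sqsubseteq> v"
      using uv e by (auto simp: S_def)
    obtain y where y: "y \<in> N" "y \<in> {x, x'}" "y \<sqsubseteq> x" "y \<sqsubseteq> x'"
      using Nlin[OF xc(1) xc'(1)] xc xc' NL le_refl by blast
    obtain d where d: "d \<in> M" "d \<in> {c, c'}" "d \<sqsubseteq> c" "d \<sqsubseteq> c'"
      using Mlin[OF xc(2) xc'(2)] xc xc' McL le_refl by blast
    have L: "u \<in> carrier L" "v \<in> carrier L" "x \<in> carrier L" "c \<in> carrier L"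
      "x' \<in> carrier L" "c' \<in> carrier L" "y \<in> carrier L" "d \<in> carrier L"
      using uv xc xc' y d NL McL by (auto simp: S_def)
    have "y \<sqinter> d \<sqsubseteq> x" "y \<sqinter> d \<sqsubseteq> c" "y \<sqinter> d \<sqsubseteq> x'" "y \<sqinter> d \<sqsubseteq> c'"
      using L y d by (meson meet_left meet_right meet_closed le_trans)+
    then have "y \<sqinter> d \<sqsubseteq> x \<sqinter> c" "y \<sqinter> d \<sqsubseteq> x' \<sqinter> c'"
      using L by (simp_all add: meet_le)
    then have "y \<sqinter> d \<sqsubseteq> u \<sqinter> v"
      using L xc(4) xc'(4) by (meson meet_closed meet_le le_trans)
    then show ?thesis
      using y d xc(3) xc'(3) by blast
  qed
  have SL: "S \<subseteq> carrier L" by (auto simp: S_def)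
  have D_sup: "D (u \<squnion> v) = D u \<union> D v" if uv: "u \<in> S" "v \<in> S" for u v
  proof
    have L: "u \<in> carrier L" "v \<in> carrier L" using uv SL by auto
    show "D u \<union> D v \<subseteq> D (u \<squnion> v)"
      using L by (simp add: mono join_left join_right)
    show "D (u \<squnion> v) \<subseteq> D u \<union> D v"
    \<comment> \<open>An \<open>e\<close> missed by both \<open>D u\<close> and \<open>D v\<close>
      is also missed at a common upper bound \<open>x \<squnion> c\<close>, where
      \<open>D_join\<close> applies.\<close>
    proof (rule ccontr)
      assume "\<not> ?thesis"
      then obtain e where e: "e \<in> D (u \<squnion> v)" "e \<notin> D u \<union> D v" by auto
      with upper[OF uv] obtain x c
        where "x \<in> N" "c \<in> M" "e \<notin> D x \<union> D c" "u \<squnion> v \<sqsubseteq> x \<squnion> c" by blast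
      moreover then have xL: "x \<in> carrier L" "c \<in> carrier L" using NL McL by auto
      ultimately have "D (u \<squnion> v) \<subseteq> D x \<union> D c"
        using L mono[of "u \<squnion> v" "x \<squnion> c"] D_join[of x c] by auto
      then show False using e \<open>e \<notin> D x \<union> D c\<close> by blast
    qed
  qed
  have D_inf: "D (u \<sqinter> v) = D u \<inter> D v" if uv: "u \<in> S" "v \<in> S" for u v
  proof
    have L: "u \<in> carrier L" "v \<in> carrier L" using uv SL by auto
    show "D (u \<sqinter> v) \<subseteq> D u \<inter> D v"
      using L by (simp add: mono meet_left meet_right)
    show "D u \<inter> D v \<subseteq> D (u \<sqinter> v)"
    proof
      fix e assume "e \<in> D u \<inter> D v"
      with lower[OF uv] obtain x c
        where "x \<in> N" "c \<in> M" "e \<in> D x \<inter> D c" "x \<sqinter> c \<sqsubseteq> u \<sqinter> v" by blast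
      moreover then have xL: "x \<in> carrier L" "c \<in> carrier L" using NL McL by auto
      ultimately have "D x \<inter> D c \<subseteq> D (u \<sqinter> v)"
        using L mono[of "x \<sqinter> c" "u \<sqinter> v"] D_meet[of x c] by auto
      then show "e \<in> D (u \<sqinter> v)" using \<open>e \<in> D x \<inter> D c\<close> by blast
    qed
  qed
  have "u \<squnion> v \<in> S" if uv: "u \<in> S" "v \<in> S" for u v
  proof -
    have L: "u \<in> carrier L" "v \<in> carrier L" using uv SL by auto
    have "\<exists>x\<in>N. \<exists>c\<in>M. e \<in> D x \<inter> D c \<and> x \<sqinter> c \<sqsubseteq> u \<squnion> v" if e: "e \<in> D (u \<squnion> v)" for e
    proof -
      \<comment> \<open>By \<open>D_sup\<close>, \<open>e\<close> already lies in \<open>D u\<close>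
        or \<open>D v\<close>, so a lower witness for that one element serves for the join.\<close>
      obtain w where w: "w \<in> {u, v}" "e \<in> D w" using e D_sup[OF uv] by auto
      then have "w \<in> S" and le: "w \<sqsubseteq> u \<squnion> v" using uv L by (auto intro: join_left join_right)
      then obtain x c where xc: "x \<in> N" "c \<in> M" "e \<in> D x \<inter> D c" "x \<sqinter> c \<sqsubseteq> w"
        using w by (auto simp: S_def)
      then have "x \<in> carrier L" "c \<in> carrier L" "w \<in> carrier L"
        using \<open>w \<in> S\<close> SL NL McL by blast+
      then have "x \<sqinter> c \<sqsubseteq> u \<squnion> v"
        using le_trans[OF xc(4) le] L by simp
      then show ?thesis using xc by blast
    qed
    moreover have "\<forall>e. e \<notin> D (u \<squnion> v) \<longrightarrow> (\<exists>x\<in>N. \<exists>c\<in>M. e \<notin> D x \<union> D c \<and> u \<squnion> v \<sqsubseteq> x \<squnion> c)"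
      using upper[OF uv] unfolding D_sup[OF uv] by blast
    ultimately show ?thesis using L join_closed meet_closed unfolding S_def by blast
  qed
  moreover have "u \<sqinter> v \<in> S" if uv: "u \<in> S" "v \<in> S" for u v
  proof -
    have L: "u \<in> carrier L" "v \<in> carrier L" using uv SL by auto
    have "\<exists>x\<in>N. \<exists>c\<in>M. e \<notin> D x \<union> D c \<and> u \<sqinter> v \<sqsubseteq> x \<squnion> c" if e: "e \<notin> D (u \<sqinter> v)" for e
    proof -
      obtain w where w: "w \<in> {u, v}" "e \<notin> D w" using e D_inf[OF uv] by auto
      then have "w \<in> S" and le: "u \<sqinter> v \<sqsubseteq> w" using uv L by (auto intro: meet_left meet_right)
      then obtain x c where xc: "x \<in> N" "c \<in> M" "e \<notin> D x \<union> D c" "w \<sqsubseteq> x \<squnion> c"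
        using w by (auto simp: S_def)
      then have "x \<in> carrier L" "c \<in> carrier L" "w \<in> carrier L"
        using \<open>w \<in> S\<close> SL NL McL by blast+
      then have "u \<sqinter> v \<sqsubseteq> x \<squnion> c"
        using le_trans[OF le xc(4)] L by simp
      then show ?thesis using xc by blast
    qed
    moreover have "\<forall>e\<in>D (u \<sqinter> v). \<exists>x\<in>N. \<exists>c\<in>M. e \<in> D x \<inter> D c \<and> x \<sqinter> c \<sqsubseteq> u \<sqinter> v"
      using lower[OF uv] unfolding D_inf[OF uv] by blast
    ultimately show ?thesis using L join_closed meet_closed unfolding S_def by blast
  qed
  ultimately have sub: "sublattice L S"
    using SL by (simp add: sublattice_def)
  have bt: "b \<in> N" "t \<in> N" "b \<in> carrier L" "t \<in> carrier L"
    using bot top McL by (auto simp: N_def)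
  \<comment> \<open>For \<open>a\<close> in \<open>N\<close> the witnesses are
    \<open>a \<sqinter> t\<close> and \<open>a \<squnion> b\<close>; for \<open>a\<close> in
    \<open>M\<close> they are \<open>t \<sqinter> a\<close> and
    \<open>b \<squnion> a\<close>.\<close>
  have "a \<in> S" if a: "a \<in> M \<union> N" for a
  proof -
    have aL: "a \<in> carrier L" using a McL NL by auto
    then have "D a \<subseteq> D t" "D b \<subseteq> D a"
      using mono bot top bt by auto
    then show ?thesis
      using a aL bt bot(1) top(1) meet_left[of a t] meet_right[of t a] join_left[of a b] join_right[of b a]
      unfolding S_def by blast
  qed
  then have MCS: "M \<union> C \<subseteq> S" by (auto simp: N_def)
  have distr: "x \<sqinter> (y \<squnion> z) = (x \<sqinter> y) \<squnion> (x \<sqinter> z)" if "x \<in> S" "y \<in> S" "z \<in> S" for x y z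
  proof -
    have L: "x \<in> carrier L" "y \<in> carrier L" "z \<in> carrier L" using that SL by auto
    have S: "y \<squnion> z \<in> S" "x \<sqinter> y \<in> S" "x \<sqinter> z \<in> S"
      using sub that by (auto simp: sublattice_def)
    have "y \<sqsubseteq> y \<squnion> z" "z \<sqsubseteq> y \<squnion> z"
      using L by (simp_all add: join_left join_right)
    then have "x \<sqinter> y \<sqsubseteq> x \<sqinter> (y \<squnion> z)" "x \<sqinter> z \<sqsubseteq> x \<sqinter> (y \<squnion> z)"
      using L by (meson meet_closed join_closed meet_le meet_left meet_right le_trans)+
    then have "(x \<sqinter> y) \<squnion> (x \<sqinter> z) \<sqsubseteq> x \<sqinter> (y \<squnion> z)"
      using L by (simp add: join_le)
    \<comment> \<open>\<open>strict\<close> separates only comparable elements, so the inequality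
      valid in every lattice comes first; distributivity of the powerset supplies the equality of
      the two images.\<close>
    moreover have "D ((x \<sqinter> y) \<squnion> (x \<sqinter> z)) = D (x \<sqinter> (y \<squnion> z))"
      using that S by (auto simp: D_sup D_inf)
    ultimately show ?thesis
      using L strict by (metis join_closed meet_closed)
  qed
  show ?thesis
    using sublattice_generated[OF sub MCS] distr
    by (intro distributive_sublatticeI) (simp, meson subsetD)
qed

section \<open>Partitions as equivalence relations, and membership in PE\<close>

declare One_nat_def [simp del]

lemma same_block_sym: "same_block x i j \<Longrightarrow> same_block x j i"
  by (auto simp: same_block_def)

lemma same_block_refl: "partition_on A x \<Longrightarrow> i \<in> A \<Longrightarrow> same_block x i i"
  by (auto simp: same_block_def partition_on_def)

lemma same_block_trans:
  assumes "partition_on A x" "same_block x i j" "same_block x j k"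
  shows "same_block x i k"
proof -
  have "trans {(i, j). same_block x i j}"
    using equiv_partition_on[OF assms(1)] by (simp add: equiv_def same_block_def)
  then show ?thesis using assms(2,3) by (blast dest: transD)
qed

lemma same_block_dom: "partition_on A x \<Longrightarrow> same_block x i j \<Longrightarrow> i \<in> A \<and> j \<in> A"
  by (auto simp: same_block_def partition_on_def)

text \<open>Blocks of \<open>y\<close> are disjoint, so the block through one chosen member of
  \<open>X\<close> must contain all of \<open>X\<close>. From here on the order is handled as
  inclusion of relations.\<close>

lemma refines_iff_same_block:
  assumes x: "partition_on A x" and y: "partition_on A y"
  shows "refines A x y \<longleftrightarrow> (\<forall>i j. same_block x i j \<longrightarrow> same_block y i j)"
proof
  show "refines A x y \<Longrightarrow> \<forall>i j. same_block x i j \<longrightarrow> same_block y i j"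
    unfolding refines_def same_block_def by blast
next
  assume R: "\<forall>i j. same_block x i j \<longrightarrow> same_block y i j"
  have "\<exists>Y\<in>y. X \<subseteq> Y" if "X \<in> x" for X
  proof -
    have "X \<noteq> {}" using that x by (auto simp: partition_on_def)
    then obtain i where i: "i \<in> X" by blast
    have sb: "same_block y i j" if "j \<in> X" for j
    proof -
      have "same_block x i j" using i that \<open>X \<in> x\<close> by (auto simp: same_block_def)
      then show ?thesis using R by simp
    qed
    from sb[OF i] obtain Y where Y: "Y \<in> y" "i \<in> Y"
      by (auto simp: same_block_def)
    have "j \<in> Y" if j: "j \<in> X" for j
    proof -
      obtain Z where Z: "Z \<in> y" "i \<in> Z" "j \<in> Z"
        using sb[OF j] by (auto simp: same_block_def)
      then have "Z = Y"
        using Y y by (auto simp: partition_on_def disjoint_def)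
      with Z show ?thesis by simp
    qed
    then show ?thesis using Y by blast
  qed
  then show "refines A x y" using x y by (simp add: refines_def)
qed

text \<open>Needed to express the exclusions of the blocks \<open>{n - 1, n}\<close> and
  \<open>{n}\<close> through \<open>same_block\<close>.\<close>

lemma block_iff:
  assumes x: "partition_on A x" and "i \<in> B" "i \<in> A"
  shows "B \<in> x \<longleftrightarrow> B = {k. same_block x k i}"
proof -
  obtain X where X: "X \<in> x" "i \<in> X" using assms by (auto simp: partition_on_def)
  have uniq: "Y = X" if "Y \<in> x" "i \<in> Y" for Y
    using that X x by (auto simp: partition_on_def disjoint_def)
  have "same_block x k i \<longleftrightarrow> k \<in> X" for k
  proof
    assume "same_block x k i"
    then obtain Y where "Y \<in> x" "k \<in> Y" "i \<in> Y" by (auto simp: same_block_def)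
    then show "k \<in> X" using uniq by simp
  qed (use X in \<open>auto simp: same_block_def\<close>)
  moreover have "B \<in> x \<longleftrightarrow> B = X"
    using X(1) uniq[OF _ \<open>i \<in> B\<close>] by metis
  ultimately show ?thesis by auto
qed

lemma same_block_quotient:
  assumes "equiv A r"
  shows "same_block (A // r) i j \<longleftrightarrow> (i, j) \<in> r"
proof
  assume "same_block (A // r) i j"
  then obtain X where "X \<in> A // r" "{i, j} \<subseteq> X" by (auto simp: same_block_def)
  then show "(i, j) \<in> r" by (rule in_quotient_imp_in_rel[OF assms])
next
  assume ij: "(i, j) \<in> r"
  then have i: "i \<in> A" using assms by (auto simp: equiv_def)
  show "same_block (A // r) i j"
    unfolding same_block_def
    using ij quotientI[OF i, of r] equiv_class_self[OF assms i] by (intro bexI[of _ "r `` {i}"]) auto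
qed

text \<open>
  If \<open>1 \<sim> n - 1\<close> in a noncrossing partition, then \<open>n\<close> is either a singleton or equivalent to \<open>1\<close>.
\<close>

lemma PE_iff:
  assumes n: "n \<ge> 3"
  shows "x \<in> PE n \<longleftrightarrow> partition_on {1..n} x \<and>
    (\<forall>i j k l. i < j \<and> j < k \<and> k < l \<and> same_block x i k \<and> same_block x j l \<longrightarrow> same_block x i j) \<and>
    (same_block x 1 (n - 1) \<longrightarrow> same_block x 1 n) \<and>
    (same_block x (n - 1) n \<longrightarrow> (\<exists>k<n - 1. same_block x k n))"
    (is "_ \<longleftrightarrow> _ \<and> ?nc \<and> ?one \<and> ?last")
proof (cases "partition_on {1..n} x")
  case x: True
  note dom = same_block_dom[OF x] and tr = same_block_trans[OF x]
  have "1 \<le> i \<and> i < j \<and> j < k \<and> k < l \<and> l \<le> n \<and> same_block x i k \<and> same_block x j l \<longleftrightarrow>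
      i < j \<and> j < k \<and> k < l \<and> same_block x i k \<and> same_block x j l" for i j k l
    using dom[of i k] dom[of j l] by auto
  then have "x \<in> NC n \<longleftrightarrow> ?nc"
    using x by (simp only: NC_def mem_Collect_eq simp_thms)
  moreover have "{n - 1, n} \<notin> x \<longleftrightarrow> ?last"
  proof -
    have "{n - 1, n} \<in> x \<longleftrightarrow> {n - 1, n} = {k. same_block x k n}"
      using block_iff[OF x, where i = n and B = "{n - 1, n}"] n by simp
    also have "\<dots> \<longleftrightarrow> same_block x (n - 1) n \<and> (\<forall>k. same_block x k n \<longrightarrow> k = n - 1 \<or> k = n)"
      using same_block_refl[OF x, of n] n by auto
    also have "\<dots> \<longleftrightarrow> \<not> ?last"
    proof -
      have "k = n - 1 \<or> k = n \<longleftrightarrow> \<not> k < n - 1" if "same_block x k n" for k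
        using dom[OF that] n by auto
      then show ?thesis by blast
    qed
    finally show ?thesis by simp
  qed
  moreover have "\<not> (same_block x 1 (n - 1) \<and> {n} \<in> x) \<longleftrightarrow> ?one" if ?nc
  proof -
    have single: "{n} \<in> x \<longleftrightarrow> {n} = {k. same_block x k n}"
      using block_iff[OF x, where i = n and B = "{n}"] n by simp
    have "same_block x 1 n" if one: "same_block x 1 (n - 1)" and "{n} \<notin> x"
    proof -
      obtain k where k: "same_block x k n" "k \<noteq> n"
        using \<open>{n} \<notin> x\<close> same_block_refl[OF x, of n] n unfolding single by auto
      then have "k = 1 \<or> k = n - 1 \<or> 1 < k \<and> k < n - 1 \<and> n - 1 < n"
        using dom[OF k(1)] n by auto
      then show ?thesis
      proof (elim disjE)
        assume "1 < k \<and> k < n - 1 \<and> n - 1 < n"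
        then have "same_block x 1 k" using \<open>?nc\<close> one k by blast
        then show ?thesis using k tr by blast
      next
        assume "k = n - 1"
        then show ?thesis using tr[OF one] k by simp
      qed (use k in simp)
    qed
    moreover have "\<not> same_block x 1 n" if "{n} \<in> x"
    proof
      assume "same_block x 1 n"
      then have "1 \<in> {n}" using that unfolding single by blast
      then show False using n by simp
    qed
    ultimately show ?thesis by blast
  qed
  ultimately show ?thesis
    using x unfolding PE_def mem_Collect_eq by argo
qed (simp add: PE_def NC_def)

lemma
  assumes "n \<ge> 3" "x \<in> PE n"
  shows PE_noncrossing:
      "\<lbrakk>i < j; j < k; k < l; same_block x i k; same_block x j l\<rbrakk> \<Longrightarrow> same_block x i j"
    and PE_one: "same_block x 1 (n - 1) \<Longrightarrow> same_block x 1 n"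
    and PE_last: "same_block x (n - 1) n \<Longrightarrow> \<exists>k<n - 1. same_block x k n"
proof -
  note P = assms(2)[unfolded PE_iff[OF assms(1)], THEN conjunct2]
  show "\<lbrakk>i < j; j < k; k < l; same_block x i k; same_block x j l\<rbrakk> \<Longrightarrow> same_block x i j"
    using P[THEN conjunct1] by blast
  show "same_block x 1 (n - 1) \<Longrightarrow> same_block x 1 n"
    using P[THEN conjunct2, THEN conjunct1] by blast
  show "same_block x (n - 1) n \<Longrightarrow> \<exists>k<n - 1. same_block x k n"
    using P[THEN conjunct2, THEN conjunct2] by blast
qed

text \<open>The quotient of \<open>{1..n}\<close> by \<open>R\<close> is the required partition, so
  later constructions only describe a relation and check on it the conditions of
  \<open>PE_iff\<close>.\<close>

lemma PE_exists:
  assumes n: "n \<ge> 3"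
    and refl: "\<And>i. i \<in> {1..n} \<Longrightarrow> R i i"
    and dom: "\<And>i j. R i j \<Longrightarrow> i \<in> {1..n}"
    and sym: "\<And>i j. R i j \<Longrightarrow> R j i"
    and trans: "\<And>i j k. R i j \<Longrightarrow> R j k \<Longrightarrow> R i k"
    and nc: "\<And>i j k l. i < j \<Longrightarrow> j < k \<Longrightarrow> k < l \<Longrightarrow> R i k \<Longrightarrow> R j l \<Longrightarrow> R i j"
    and one: "R 1 (n - 1) \<Longrightarrow> R 1 n"
    and last: "R (n - 1) n \<Longrightarrow> \<exists>k<n - 1. R k n"
  shows "\<exists>x\<in>PE n. same_block x = R"
proof -
  have eq: "equiv {1..n} {(i, j). R i j}"
  proof (intro equivI refl_onI symI transI)
    show "{(i, j). R i j} \<subseteq> {1..n} \<times> {1..n}" using dom sym by blast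
    show "(i, i) \<in> {(i, j). R i j}" if "i \<in> {1..n}" for i
      using refl[OF that] by simp
    show "(j, i) \<in> {(i, j). R i j}" if "(i, j) \<in> {(i, j). R i j}" for i j
      using that sym by blast
    show "(i, k) \<in> {(i, j). R i j}"
      if "(i, j) \<in> {(i, j). R i j}" "(j, k) \<in> {(i, j). R i j}" for i j k
      using that trans[of i j k] by simp
  qed
  have same: "same_block ({1..n} // {(i, j). R i j}) = R"
    using same_block_quotient[OF eq] by (simp add: fun_eq_iff)
  have "{1..n} // {(i, j). R i j} \<in> PE n"
    unfolding PE_iff[OF n] same
  proof (intro conjI allI impI)
    show "partition_on {1..n} ({1..n} // {(i, j). R i j})"
      by (rule partition_on_quotient[OF eq])
    show "R i j" if "i < j \<and> j < k \<and> k < l \<and> R i k \<and> R j l" for i j k l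
      using that by (elim conjE) (rule nc)
  qed (fact one last)+
  then show ?thesis using same by blast
qed

section \<open>The order on PE and its infima\<close>

lemma PE_poset_simps [simp]:
  "carrier (PE_poset n) = PE n" "eq (PE_poset n) = (=)" "le (PE_poset n) = refines {1..n}"
  by (simp_all add: PE_poset_def NC_poset_def)

lemma PE_partition: "x \<in> PE n \<Longrightarrow> partition_on {1..n} x"
  by (simp add: PE_def NC_def)

lemma PE_poset_partial_order: "partial_order (PE_poset n)"
proof unfold_locales
  fix x y assume "x \<sqsubseteq>\<^bsub>PE_poset n\<^esub> y" "y \<sqsubseteq>\<^bsub>PE_poset n\<^esub> x"
  then show "x .=\<^bsub>PE_poset n\<^esub> y" using refines_asym[of "{1..n}" x y] by simp
qed (auto intro: refines_refl refines_trans PE_partition)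

lemma PE_refines_iff:
  "x \<in> PE n \<Longrightarrow> y \<in> PE n \<Longrightarrow>
    refines {1..n} x y \<longleftrightarrow> (\<forall>i j. same_block x i j \<longrightarrow> same_block y i j)"
  by (simp add: refines_iff_same_block PE_partition)

text \<open>
  The common refinement of members of \<open>PE n\<close> can only fail to be in \<open>PE n\<close> by having the block
  \<open>{n - 1, n}\<close>, and then this block has to be split.
\<close>

lemma PE_inf_exists:
  assumes n: "n \<ge> 3" and F: "F \<subseteq> PE n" "F \<noteq> {}"
  shows "\<exists>z\<in>PE n. (\<forall>x\<in>F. refines {1..n} z x) \<and>
    (\<forall>y\<in>PE n. (\<forall>x\<in>F. refines {1..n} y x) \<longrightarrow> refines {1..n} y z)"
proof -
  define s where "s i j \<longleftrightarrow> (\<forall>x\<in>F. same_block x i j)" for i j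
  have part: "partition_on {1..n} x" if "x \<in> F" for x
    using that F PE_partition by blast
  have sI: "s i j" if "\<And>x. x \<in> F \<Longrightarrow> same_block x i j" for i j
    using that by (simp add: s_def)
  have sD: "same_block x i j" if "s i j" "x \<in> F" for i j x
    using that by (simp add: s_def)
  have srefl: "s i i" if "i \<in> {1..n}" for i
    by (rule sI, rule same_block_refl[OF part that])
  have sdom: "i \<in> {1..n}" if "s i j" for i j
  proof -
    obtain x where x: "x \<in> F" using F(2) by blast
    show ?thesis using same_block_dom[OF part[OF x] sD[OF that x]] by simp
  qed
  have ssym: "s j i" if "s i j" for i j
    by (rule sI, rule same_block_sym, rule sD[OF that])
  have strans: "s i k" if "s i j" "s j k" for i j k
    by (rule sI, rule same_block_trans[OF part sD[OF that(1)] sD[OF that(2)]])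
  have snc: "s i j" if "i < j" "j < k" "k < l" "s i k" "s j l" for i j k l
    by (rule sI, rule PE_noncrossing[OF n _ that(1-3) sD[OF that(4)] sD[OF that(5)]]) (use F in auto)
  have sone: "s 1 n" if "s 1 (n - 1)"
    by (rule sI, rule PE_one[OF n _ sD[OF that]]) (use F in auto)
  \<comment> \<open>The third disjunct is the witness demanded by \<open>PE_last\<close>: the pair
    \<open>n - 1, n\<close> survives only together with a smaller partner.\<close>
  define R where "R i j \<longleftrightarrow> s i j \<and> (i = j \<or> {i, j} \<noteq> {n - 1, n} \<or> (\<exists>k<n - 1. s k n))" for i j
  have "\<exists>z\<in>PE n. same_block z = R"
  proof (cases "s (n - 1) n \<and> \<not> (\<exists>k<n - 1. s k n)")
    case False
    then have "R i j \<longleftrightarrow> s i j" for i j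
      using ssym[of i j] unfolding R_def doubleton_eq_iff by blast
    then have "R = s" by (simp add: fun_eq_iff)
    moreover have "\<exists>z\<in>PE n. same_block z = s"
    proof (rule PE_exists[OF n])
      show "s (n - 1) n \<Longrightarrow> \<exists>k<n - 1. s k n" using False by blast
    qed (fact srefl sdom ssym strans snc sone)+
    ultimately show ?thesis by simp
  next
    case True
    \<comment> \<open>In this case \<open>{n - 1, n}\<close> is a class of \<open>s\<close>.
      Splitting it leaves two singletons, so the two special conditions of \<open>PE_iff\<close>
      become vacuous (\<open>1 < n - 1\<close> as \<open>n \<ge> 3\<close>).\<close>
    have R: "R i j \<longleftrightarrow> s i j \<and> (i = j \<or> i < n - 1 \<and> j < n - 1)" for i j
    proof -
      have "i < n - 1" if ij: "s i j" "i \<noteq> j" "{i, j} \<noteq> {n - 1, n}" for i j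
      proof (rule ccontr)
        assume "\<not> i < n - 1"
        then have i: "i = n - 1 \<or> i = n" using sdom[OF ij(1)] by auto
        have "s i n" using i True srefl[of n] n by auto
        then have jn: "s j n" using strans[OF ssym[OF ij(1)]] by simp
        then have "\<not> j < n - 1" using True by blast
        then have "j = n - 1 \<or> j = n" using sdom[OF jn] by auto
        then show False using i ij by auto
      qed
      note small = this
      show ?thesis
      proof (cases "i = j")
        case False
        then show ?thesis
          using True small[of i j] small[of j i] ssym[of i j]
          unfolding R_def by (auto simp: insert_commute)
      qed (simp add: R_def)
    qed
    show ?thesis
    proof (rule PE_exists[OF n])
      show "R i i" if "i \<in> {1..n}" for i using srefl[OF that] by (simp add: R)
      show "i \<in> {1..n}" if "R i j" for i j using that sdom[of i j] by (simp add: R)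
      show "R j i" if "R i j" for i j using that ssym[of i j] by (auto simp: R)
      show "R i k" if "R i j" "R j k" for i j k using that strans[of i j k] by (auto simp: R)
      show "R i j" if "i < j" "j < k" "k < l" "R i k" "R j l" for i j k l
        using that snc[of i j k l] by (simp add: R)
    qed (use n in \<open>auto simp: R\<close>)
  qed
  then obtain z where z: "z \<in> PE n" "same_block z = R" by blast
  have "refines {1..n} y z" if y: "y \<in> PE n" "\<forall>x\<in>F. refines {1..n} y x" for y
  proof -
    have ys: "s i j" if "same_block y i j" for i j
    proof (rule sI)
      fix x assume "x \<in> F"
      then have "x \<in> PE n" "refines {1..n} y x" using F y by auto
      then show "same_block x i j" using that PE_refines_iff[OF y(1)] by simp
    qed
    \<comment> \<open>If \<open>y\<close> relates \<open>n - 1\<close> to \<open>n\<close>, it also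
      relates some \<open>k < n - 1\<close> to \<open>n\<close>, and this relation passes to
      \<open>s\<close>. Hence \<open>y\<close> never needs a pair that \<open>R\<close> has
      removed.\<close>
    have "\<exists>k<n - 1. s k n" if "same_block y i j" "{i, j} = {n - 1, n}" for i j
    proof -
      have "same_block y (n - 1) n"
        using that same_block_sym[of y i j] by (auto simp: doubleton_eq_iff)
      from PE_last[OF n y(1) this] show ?thesis using ys by blast
    qed
    then show ?thesis
      unfolding PE_refines_iff[OF y(1) z(1)] z(2) R_def using ys by blast
  qed
  moreover have "\<forall>x\<in>F. refines {1..n} z x"
  proof
    fix x assume "x \<in> F"
    moreover then have "x \<in> PE n" using F by blast
    ultimately show "refines {1..n} z x"
      using z by (simp add: PE_refines_iff R_def s_def)
  qed
  ultimately show ?thesis using z by blast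
qed

section \<open>The chain of initial blocks and the nonminimal elements\<close>

text \<open>
  Reduction modulo \<open>n\<close> puts \<open>n\<close> first: the large block of \<open>initial_block n i\<close> is \<open>{n, 1, \<dots>, i}\<close>, and
  \<open>nonmin n x\<close> omits the minimum of each block in the order \<open>n, 1, \<dots>, n - 1\<close>. Its cardinality is the
  rank of \<open>x\<close>.
\<close>

definition initial_block :: "nat \<Rightarrow> nat \<Rightarrow> nat set set" where
  "initial_block n i = {1..n} // {(a, b). a \<in> {1..n} \<and> b \<in> {1..n} \<and>
     (a = b \<or> a mod n \<le> i \<and> b mod n \<le> i)}"

definition nonmin :: "nat \<Rightarrow> nat set set \<Rightarrow> nat set" where
  "nonmin n x = {i. \<exists>j. same_block x i j \<and> j mod n < i mod n}"

lemma equiv_initial_block: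
  "equiv {1..n} {(a, b). a \<in> {1..n} \<and> b \<in> {1..n} \<and> (a = b \<or> a mod n \<le> i \<and> b mod n \<le> i)}"
  by (intro equivI refl_onI symI transI) auto

lemma same_block_initial:
  "same_block (initial_block n i) a b \<longleftrightarrow>
    a \<in> {1..n} \<and> b \<in> {1..n} \<and> (a = b \<or> a mod n \<le> i \<and> b mod n \<le> i)"
  using same_block_quotient[OF equiv_initial_block] by (simp add: initial_block_def)

text \<open>At most one block is nontrivial, so two crossing pairs both lie in it. That block
  contains \<open>n\<close>, and it contains \<open>1\<close> as soon as it contains
  \<open>n - 1\<close>.\<close>

lemma initial_block_PE:
  assumes n: "n \<ge> 3"
  shows "initial_block n i \<in> PE n"
proof -
  let ?R = "same_block (initial_block n i)"
  have "partition_on {1..n} (initial_block n i)"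
    unfolding initial_block_def by (rule partition_on_quotient[OF equiv_initial_block])
  moreover have "?R a b" if "a < b" "b < k" "k < l" "?R a k" "?R b l" for a b k l
    using that by (simp add: same_block_initial)
  moreover have "?R 1 n" if "?R 1 (n - 1)"
    using that n by (auto simp: same_block_initial)
  moreover have "?R 1 n" if "?R (n - 1) n"
    using that n by (auto simp: same_block_initial)
  moreover have "1 < n - 1" using n by simp
  ultimately show ?thesis
    unfolding PE_iff[OF n] by blast
qed

lemma mod_self_interval: "i \<in> {1..n} \<Longrightarrow> i mod n = (if i = n then 0 else i)" for i n :: nat
  by auto

text \<open>The residue \<open>0\<close> makes \<open>n\<close> the omitted minimum. The chain thus
  maps to the complete flag of initial segments of \<open>{1..n - 1}\<close>, one for each
  cardinality.\<close>

lemma nonmin_initial: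
  assumes "i < n"
  shows "nonmin n (initial_block n i) = {1..i}"
proof -
  have "a \<in> nonmin n (initial_block n i)" if "a \<in> {1..i}" for a
    using that assms by (auto simp: nonmin_def same_block_initial intro!: exI[of _ n])
  moreover have "a \<in> {1..i}" if "a \<in> nonmin n (initial_block n i)" for a
    using that by (auto simp: nonmin_def same_block_initial mod_self_interval split: if_splits)
  ultimately show ?thesis by blast
qed

lemma nonmin_mono:
  "x \<in> PE n \<Longrightarrow> y \<in> PE n \<Longrightarrow> refines {1..n} x y \<Longrightarrow> nonmin n x \<subseteq> nonmin n y"
  unfolding nonmin_def by (simp only: PE_refines_iff) blast

lemma nonmin_subset: "x \<in> PE n \<Longrightarrow> nonmin n x \<subseteq> {1..n - 1}"
  using same_block_dom[OF PE_partition] unfolding nonmin_def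
  by (fastforce simp: mod_self_interval split: if_splits)

lemma minimum_exists:
  assumes x: "x \<in> PE n" and i: "i \<in> {1..n}"
  shows "\<exists>m. same_block x i m \<and> m \<notin> nonmin n x"
proof -
  note x = PE_partition[OF x]
  obtain m where m: "same_block x i m" "\<And>k. same_block x i k \<Longrightarrow> m mod n \<le> k mod n"
    using ex_has_least_nat[of "same_block x i" i "\<lambda>k. k mod n"] same_block_refl[OF x i] by auto
  then have "m \<notin> nonmin n x"
    using same_block_trans[OF x] unfolding nonmin_def by (auto simp: not_less[symmetric])
  with m show ?thesis by blast
qed

text \<open>Residues are distinct on \<open>{1..n}\<close>, so a block of \<open>y\<close> has a
  single element outside \<open>nonmin n y\<close>. The minima of all blocks of \<open>x\<close>
  inside it must equal that element, so there is only one such block.\<close>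

lemma nonmin_strict:
  assumes xy: "x \<in> PE n" "y \<in> PE n" "refines {1..n} x y" and eq: "nonmin n x = nonmin n y"
  shows "x = y"
proof -
  note x = PE_partition[OF xy(1)] and y = PE_partition[OF xy(2)]
  have sub: "same_block y i j" if "same_block x i j" for i j
    using that xy by (simp add: PE_refines_iff)
  have "same_block x i j" if ij: "same_block y i j" for i j
  proof -
    obtain a where a: "same_block x i a" "a \<notin> nonmin n y"
      using minimum_exists[OF xy(1)] same_block_dom[OF y ij] eq by metis
    obtain b where b: "same_block x j b" "b \<notin> nonmin n y"
      using minimum_exists[OF xy(1)] same_block_dom[OF y ij] eq by metis
    have ab: "same_block y a b"
      using sub a b ij same_block_trans[OF y] same_block_sym by metis
    then have "a mod n = b mod n"
      using a b same_block_sym[OF ab] by (auto simp: nonmin_def not_less intro: antisym)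
    then have "a = b"
      using same_block_dom[OF y ab] by (auto simp: mod_self_interval split: if_splits)
    then show ?thesis
      using a b same_block_trans[OF x] same_block_sym by metis
  qed
  then show ?thesis
    using xy refines_asym by (metis PE_refines_iff)
qed

section \<open>Bounds for pairs with one member in the chain\<close>

text \<open>Here the common refinement needs no splitting: if \<open>initial_block n i\<close>
  relates \<open>n - 1\<close> to \<open>n\<close>, then \<open>i\<close> is so large that all
  elements are in its large block, and the third partner provided by \<open>x\<close>
  survives.\<close>

lemma PE_meet_initial:
  assumes n: "n \<ge> 3" and x: "x \<in> PE n" and i: "i < n"
  obtains z where "z \<in> PE n" "refines {1..n} z x" "refines {1..n} z (initial_block n i)"
    "nonmin n x \<inter> nonmin n (initial_block n i) \<subseteq> nonmin n z"
proof -
  let ?c = "initial_block n i"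
  define R where "R a b \<longleftrightarrow> same_block x a b \<and> same_block ?c a b" for a b
  note c = initial_block_PE[OF n, of i]
  note px = PE_partition[OF x] and pc = PE_partition[OF c]
  have "\<exists>z\<in>PE n. same_block z = R"
  proof (rule PE_exists[OF n])
    show "R a a" if "a \<in> {1..n}" for a
      using same_block_refl[OF px that] same_block_refl[OF pc that] by (simp add: R_def)
    show "a \<in> {1..n}" if "R a b" for a b
      using that same_block_dom[OF px, of a b] by (simp add: R_def)
    show "R b a" if "R a b" for a b
      using that same_block_sym[of x a b] same_block_sym[of ?c a b] by (simp add: R_def)
    show "R a d" if "R a b" "R b d" for a b d
      using that same_block_trans[OF px, of a b d] same_block_trans[OF pc, of a b d]
      by (simp add: R_def)
    show "R a b" if "a < b" "b < k" "k < l" "R a k" "R b l" for a b k l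
      using that PE_noncrossing[OF n x, of a b k l] PE_noncrossing[OF n c, of a b k l]
      by (simp add: R_def)
    show "R 1 n" if "R 1 (n - 1)"
      using that PE_one[OF n x] PE_one[OF n c] unfolding R_def by blast
    show "\<exists>k<n - 1. R k n" if last: "R (n - 1) n"
    proof -
      obtain k where k: "k < n - 1" "same_block x k n"
        using last PE_last[OF n x] unfolding R_def by blast
      have "n - 1 \<le> i"
        using last n by (auto simp: R_def same_block_initial)
      then have "same_block ?c k n"
        using k n same_block_dom[OF px k(2)] by (auto simp: same_block_initial)
      then show ?thesis using k by (auto simp: R_def)
    qed
  qed
  then obtain z where z: "z \<in> PE n" "same_block z = R" by blast
  have "nonmin n x \<inter> nonmin n ?c \<subseteq> nonmin n z"
  proof
    fix e assume e: "e \<in> nonmin n x \<inter> nonmin n ?c"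
    then obtain j where j: "same_block x e j" "j mod n < e mod n"
      by (auto simp: nonmin_def)
    \<comment> \<open>The large block is downward closed in the rotated order, so it contains the
      smaller partner \<open>j\<close> along with \<open>e\<close>.\<close>
    have "e \<le> i" using e nonmin_initial[OF i] by auto
    then have "e mod n \<le> i" by (meson mod_less_eq_dividend order_trans)
    then have "same_block ?c e j"
      using j same_block_dom[OF px j(1)] by (auto simp: same_block_initial)
    then show "e \<in> nonmin n z"
      using j z by (auto simp: nonmin_def R_def)
  qed
  then show thesis
    using that z x c by (auto simp: PE_refines_iff R_def)
qed

lemma PE_join_initial:
  assumes n: "n \<ge> 3" and x: "x \<in> PE n" and i: "i < n"
  obtains z where "z \<in> PE n" "refines {1..n} x z" "refines {1..n} (initial_block n i) z"
    "nonmin n z \<subseteq> nonmin n x \<union> nonmin n (initial_block n i)"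
proof -
  let ?c = "initial_block n i"
  \<comment> \<open>\<open>U\<close> holds on the union of the blocks of \<open>x\<close> that meet
    the large block \<open>{n, 1, ..., i}\<close>; \<open>R\<close> merges exactly these.\<close>
  define U where "U a \<longleftrightarrow> (\<exists>b. same_block x a b \<and> b mod n \<le> i)" for a
  define R where "R a b \<longleftrightarrow> same_block x a b \<or> U a \<and> U b" for a b
  note c = initial_block_PE[OF n, of i]
  note px = PE_partition[OF x]
  note dom = same_block_dom[OF px] and tr = same_block_trans[OF px] and sy = same_block_sym[of x]
  have nc: "same_block x a b" if "a < b" "b < k" "k < l" "same_block x a k" "same_block x b l" for a b k l
    using that by (rule PE_noncrossing[OF n x])
  \<comment> \<open>Noncrossing refers to the unrotated order, where the large block sits at both
    ends: its members lie either at or below \<open>i\<close>, or at \<open>n\<close>.\<close>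
  have U_small_or_n: "\<exists>e. same_block x a e \<and> (e = n \<or> e \<le> i)" if U: "U a" for a
  proof -
    obtain e where e: "same_block x a e" "e mod n \<le> i" using U by (auto simp: U_def)
    then have "e = n \<or> e \<le> i" using dom[OF e(1)] by (auto simp: mod_self_interval split: if_splits)
    then show ?thesis using e by blast
  qed
  have U_cong: "U b" if "U a" "same_block x a b" for a b
    using that tr[OF sy] unfolding U_def by blast
  have U_cong': "U a" if "U b" "same_block x a b" for a b
    using U_cong[OF that(1) sy[OF that(2)]] .
  have U_small: "U a" if "a \<in> {1..n}" "a mod n \<le> i" for a
    using that same_block_refl[OF px that(1)] unfolding U_def by blast
  have "\<exists>z\<in>PE n. same_block z = R"
  proof (rule PE_exists[OF n])
    show "R a a" if "a \<in> {1..n}" for a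
      using same_block_refl[OF px that] by (simp add: R_def)
    show "a \<in> {1..n}" if "R a b" for a b
      using that dom[of a] unfolding R_def U_def by blast
    show "R b a" if "R a b" for a b
      using that sy[of a b] unfolding R_def by blast
    show "R a d" if "R a b" "R b d" for a b d
      using that tr[of a b d] U_cong[of b d] U_cong'[of b a] unfolding R_def by blast
    show "R a b" if abkl: "a < b" "b < k" "k < l" and R: "R a k" "R b l" for a b k l
    proof -
      have big: "i < e \<and> e < n" if "\<not> U e" "e \<in> {1..n}" for e
      proof -
        have "\<not> e mod n \<le> i" using that U_small by blast
        then show ?thesis using that(2) by (auto simp: mod_self_interval split: if_splits)
      qed
      \<comment> \<open>Only the mixed cases are new. Outside \<open>U\<close> all elements lie
        strictly between \<open>i\<close> and \<open>n\<close>, so the partner \<open>e\<close> of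
        the merged element is beyond one end of the unmerged pair. The two pairs of \<open>x\<close>
        then cross, which pulls the unmerged pair into \<open>U\<close>.\<close>
      have "U b" if U: "U k" and bl: "same_block x b l"
      proof (rule ccontr)
        assume nb: "\<not> U b"
        then have "\<not> U l" using U_cong'[OF _ bl] by blast
        then have "i < b" "l < n" using nb big dom[OF bl] by auto
        obtain e where e: "same_block x k e" "e = n \<or> e \<le> i"
          using U_small_or_n[OF U] by blast
        have "same_block x b k \<or> same_block x e b"
          using e nc[of b k l n, OF _ _ _ bl] nc[of e b k l, OF _ _ _ sy[OF e(1)] bl]
            abkl \<open>l < n\<close> \<open>i < b\<close> by auto
        then show False
          using nb U U_cong'[of k b] U_cong[OF U e(1)] U_cong[of e b] by blast
      qed
      moreover have "U a" if U: "U b" and ak: "same_block x a k"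
      proof (rule ccontr)
        assume na: "\<not> U a"
        then have "\<not> U k" using U_cong'[OF _ ak] by blast
        then have "i < a" "k < n" using na big dom[OF ak] by auto
        obtain e where e: "same_block x b e" "e = n \<or> e \<le> i"
          using U_small_or_n[OF U] by blast
        have "same_block x a b \<or> same_block x e a"
          using e nc[of a b k n, OF _ _ _ ak] nc[of e a b k, OF _ _ _ sy[OF e(1)] ak]
            abkl \<open>k < n\<close> \<open>i < a\<close> by auto
        then show False
          using na U U_cong'[of b a] U_cong[OF U e(1)] U_cong[of e a] by blast
      qed
      ultimately show ?thesis
        using R nc[OF abkl] unfolding R_def by blast
    qed
    show "R 1 n" if "R 1 (n - 1)"
    proof -
      have "U n" using n by (intro U_small) auto
      then show ?thesis
        using that PE_one[OF n x] \<open>U n\<close> unfolding R_def by blast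
    qed
    show "\<exists>k<n - 1. R k n" if "R (n - 1) n"
    \<comment> \<open>For \<open>i = 0\<close> nothing is merged and the witness comes from
      \<open>x\<close>; otherwise \<open>1\<close> is in the merged block and is the
      witness.\<close>
    proof (cases "i = 0")
      case True
      have Un: "same_block x a n" if "U a" for a
        using U_small_or_n[OF that] True dom[of a 0] by auto
      have "same_block x (n - 1) n"
        using that Un[of "n - 1"] unfolding R_def by blast
      then show ?thesis
        using PE_last[OF n x] unfolding R_def by blast
    next
      case False
      then have "U 1" "U n" using n by (auto intro!: U_small)
      then show ?thesis using n by (intro exI[of _ 1]) (auto simp: R_def)
    qed
  qed
  then obtain z where z: "z \<in> PE n" "same_block z = R" by blast
  have "nonmin n z \<subseteq> nonmin n x \<union> nonmin n ?c"
  proof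
    fix e assume "e \<in> nonmin n z"
    then obtain j where j: "R e j" "j mod n < e mod n"
      using z by (auto simp: nonmin_def)
    show "e \<in> nonmin n x \<union> nonmin n ?c"
    proof (cases "same_block x e j")
      case True
      then show ?thesis using j by (auto simp: nonmin_def)
    next
      case False
      then obtain b where b: "same_block x e b" "b mod n \<le> i"
        using j by (auto simp: R_def U_def)
      \<comment> \<open>Merging can give \<open>e\<close> a smaller partner only if its block in
        \<open>x\<close> reaches some \<open>b\<close> of residue at most \<open>i\<close>. Either
        \<open>e\<close> has such a residue itself, and it is nonzero, or \<open>b\<close> is
        already smaller than \<open>e\<close>.\<close>
      show ?thesis
      proof (cases "e mod n \<le> i")
        case True
        then have "e \<in> {1..i}"
          using dom[OF b(1)] j(2) by (auto simp: mod_self_interval split: if_splits)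
        then show ?thesis using nonmin_initial[OF i] by blast
      next
        case False
        then show ?thesis using b by (auto simp: nonmin_def)
      qed
    qed
  qed
  moreover have "refines {1..n} ?c z"
    unfolding PE_refines_iff[OF c z(1)] z(2) R_def same_block_initial
    using same_block_refl[OF px] U_small by blast
  ultimately show thesis
    using that z x by (auto simp: PE_refines_iff R_def)
qed

section \<open>Completeness, maximality of the chain, and supersolvability\<close>

lemma initial_block_bot:
  assumes n: "n \<ge> 3" and x: "x \<in> PE n"
  shows "refines {1..n} (initial_block n 0) x"
proof -
  have "same_block x i j" if ij: "same_block (initial_block n 0) i j" for i j
  proof -
    have "i \<in> {1..n}" "j \<in> {1..n}" "i = j \<or> i mod n = 0 \<and> j mod n = 0"
      using ij by (simp_all add: same_block_initial)
    then have "i = j"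
      using mod_self_interval[of i n] mod_self_interval[of j n] by (auto split: if_splits)
    then show ?thesis
      using same_block_refl[OF PE_partition[OF x] \<open>i \<in> {1..n}\<close>] by simp
  qed
  then show ?thesis using x initial_block_PE[OF n] by (simp add: PE_refines_iff)
qed

lemma initial_block_top:
  assumes n: "n \<ge> 3" and x: "x \<in> PE n"
  shows "refines {1..n} x (initial_block n (n - 1))"
proof -
  have "same_block (initial_block n (n - 1)) i j" if "same_block x i j" for i j
    using same_block_dom[OF PE_partition[OF x] that] n
    by (auto simp: same_block_initial mod_self_interval)
  then show ?thesis using x initial_block_PE[OF n] by (simp add: PE_refines_iff)
qed

text \<open>A greatest element and all nonempty infima force suprema to exist, so joins in
  \<open>PE n\<close> need no explicit description.\<close>

lemma PE_poset_complete_lattice: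
  assumes n: "n \<ge> 3"
  shows "complete_lattice (PE_poset n)"
proof -
  interpret partial_order "PE_poset n" by (rule PE_poset_partial_order)
  let ?t = "initial_block n (n - 1)"
  have t: "?t \<in> PE n" by (rule initial_block_PE[OF n])
  show ?thesis
  proof (rule complete_lattice_criterion1)
    show "\<exists>g. greatest (PE_poset n) g (carrier (PE_poset n))"
      using t initial_block_top[OF n] by (auto simp: greatest_def)
  next
    fix F assume "F \<subseteq> carrier (PE_poset n)" "F \<noteq> {}"
    then have F: "F \<subseteq> PE n" "F \<noteq> {}" by simp_all
    from PE_inf_exists[OF n F] obtain z where "z \<in> PE n" "\<forall>x\<in>F. refines {1..n} z x"
      "\<forall>y\<in>PE n. (\<forall>x\<in>F. refines {1..n} y x) \<longrightarrow> refines {1..n} y z" by blast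
    then have "is_glb (PE_poset n) z F"
      using F by (auto simp: greatest_def Lower_def subset_iff)
    then show "\<exists>z. is_glb (PE_poset n) z F" by blast
  qed
qed

lemma finite_PE: "finite (PE n)"
proof (rule finite_subset)
  show "PE n \<subseteq> Pow (Pow {1..n})"
  proof
    fix x assume "x \<in> PE n"
    from PE_partition[OF this] show "x \<in> Pow (Pow {1..n})"
      unfolding partition_on_def by blast
  qed
qed simp

lemma initial_block_mono:
  assumes n: "n \<ge> 3" and "i \<le> j"
  shows "refines {1..n} (initial_block n i) (initial_block n j)"
  using assms by (auto simp: PE_refines_iff initial_block_PE same_block_initial)

text \<open>The flag has a member of every rank. An element that extends the chain is comparable to
  the member of its own rank, and then \<open>nonmin_strict\<close> identifies the two.\<close>

lemma maxchain_initial_blocks: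
  assumes n: "n \<ge> 3"
  shows "pred_on.maxchain (PE n) (refines {1..n}) (initial_block n ` {..<n})"
  unfolding pred_on.maxchain_def
proof
  let ?M = "initial_block n ` {..<n}"
  show "pred_on.chain (PE n) (refines {1..n}) ?M"
    unfolding pred_on.chain_def
  proof (intro conjI ballI)
    show "?M \<subseteq> PE n" using initial_block_PE[OF n] by blast
    fix x y assume "x \<in> ?M" "y \<in> ?M"
    then obtain i j where "x = initial_block n i" "y = initial_block n j" by blast
    then show "(refines {1..n})\<^sup>=\<^sup>= x y \<or> (refines {1..n})\<^sup>=\<^sup>= y x"
      using initial_block_mono[OF n, of i j] initial_block_mono[OF n, of j i] linear[of i j] by auto
  qed
  show "\<nexists>S. pred_on.chain (PE n) (refines {1..n}) S \<and> ?M \<subset> S"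
  proof
    assume "\<exists>S. pred_on.chain (PE n) (refines {1..n}) S \<and> ?M \<subset> S"
    then obtain S x where S: "pred_on.chain (PE n) (refines {1..n}) S" "?M \<subset> S"
      and x: "x \<in> S" "x \<notin> ?M" by blast
    have xPE: "x \<in> PE n" using S x by (auto simp: pred_on.chain_def)
    define i where "i = card (nonmin n x)"
    have sub: "nonmin n x \<subseteq> {1..n - 1}" by (rule nonmin_subset[OF xPE])
    then have "i \<le> n - 1" using card_mono[OF _ sub] by (simp add: i_def)
    then have i: "i < n" using n by simp
    let ?c = "initial_block n i"
    have c: "?c \<in> PE n" by (rule initial_block_PE[OF n])
    have "?c \<in> S" using S(2) i by blast
    have "x \<noteq> ?c" using x(2) i by blast
    then have comp: "refines {1..n} x ?c \<or> refines {1..n} ?c x"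
      using S(1) x(1) \<open>?c \<in> S\<close> unfolding pred_on.chain_def by blast
    then have "nonmin n x \<subseteq> nonmin n ?c \<or> nonmin n ?c \<subseteq> nonmin n x"
      using nonmin_mono[OF xPE c] nonmin_mono[OF c xPE] by blast
    moreover have "finite (nonmin n x)" using sub by (rule finite_subset) simp
    moreover have "card (nonmin n ?c) = card (nonmin n x)" "finite (nonmin n ?c)"
      using nonmin_initial[OF i] by (simp_all add: i_def)
    ultimately have "nonmin n x = nonmin n ?c"
      by (metis card_subset_eq)
    then have "x = ?c"
      using comp nonmin_strict[OF xPE c] nonmin_strict[OF c xPE] by auto
    then show False using \<open>x \<noteq> ?c\<close> by simp
  qed
qed

theorem theorem1p3:
  fixes n :: nat
  assumes "n \<ge> 3"
  shows "supersolvable_lattice (PE_poset n)"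
proof -
  note n = assms
  let ?L = "PE_poset n" and ?M = "initial_block n ` {..<n}"
  interpret complete_lattice ?L by (rule PE_poset_complete_lattice[OF n])
  have M: "pred_on.maxchain (carrier ?L) (le ?L) ?M"
    using maxchain_initial_blocks[OF n] by simp
  have "distributive_lattice (?L\<lparr>carrier := generated_sublattice ?L (?M \<union> C)\<rparr>)"
    if C: "pred_on.chain (carrier ?L) (le ?L) C" for C
  proof (rule distributive_generated_sublattice[where D = "nonmin n"])
    show "pred_on.chain (carrier ?L) (le ?L) ?M"
      using M by (rule pred_on.maxchain_imp_chain)
    show "pred_on.chain (carrier ?L) (le ?L) C" by (rule C)
    show "initial_block n 0 \<in> ?M" "initial_block n (n - 1) \<in> ?M" using n by auto
    fix x assume "x \<in> carrier ?L"
    then have x: "x \<in> PE n" by simp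
    show "le ?L (initial_block n 0) x" "le ?L x (initial_block n (n - 1))"
      using initial_block_bot[OF n x] initial_block_top[OF n x] by simp_all
    fix c assume "c \<in> ?M"
    then obtain i where i: "i < n" "c = initial_block n i" by blast
    have c: "c \<in> PE n" using i initial_block_PE[OF n] by simp
    \<comment> \<open>The lattice operations are not identified with the constructed
      \<open>z\<close>: any lower bound lies below the meet and any upper bound above the join, so
      monotonicity of \<open>nonmin\<close> gives the inclusions.\<close>
    show "nonmin n x \<inter> nonmin n c \<subseteq> nonmin n (x \<sqinter>\<^bsub>?L\<^esub> c)"
    proof -
      obtain z where z: "z \<in> PE n" "refines {1..n} z x" "refines {1..n} z c"
        "nonmin n x \<inter> nonmin n c \<subseteq> nonmin n z"
        by (rule PE_meet_initial[OF n x i(1), folded i(2)])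
      then have "refines {1..n} z (x \<sqinter>\<^bsub>?L\<^esub> c)"
        using meet_le[of z x c] x c by simp
      then show ?thesis
        using nonmin_mono[OF z(1), of "x \<sqinter>\<^bsub>?L\<^esub> c"] z(4) meet_closed[of x c] x c by simp
    qed
    show "nonmin n (x \<squnion>\<^bsub>?L\<^esub> c) \<subseteq> nonmin n x \<union> nonmin n c"
    proof -
      obtain z where z: "z \<in> PE n" "refines {1..n} x z" "refines {1..n} c z"
        "nonmin n z \<subseteq> nonmin n x \<union> nonmin n c"
        by (rule PE_join_initial[OF n x i(1), folded i(2)])
      then have "refines {1..n} (x \<squnion>\<^bsub>?L\<^esub> c) z"
        using join_le[of x z c] x c by simp
      then show ?thesis
        using nonmin_mono[OF _ z(1), of "x \<squnion>\<^bsub>?L\<^esub> c"] z(4) join_closed[of x c] x c by simp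
    qed
  next
    fix x y assume "x \<in> carrier ?L" "y \<in> carrier ?L" "le ?L x y"
    then have xy: "x \<in> PE n" "y \<in> PE n" "refines {1..n} x y" by simp_all
    show "nonmin n x \<subseteq> nonmin n y" by (rule nonmin_mono[OF xy])
    show "x = y" if "nonmin n x = nonmin n y" by (rule nonmin_strict[OF xy that])
  qed
  moreover have "finite (carrier ?L)" by (simp add: finite_PE)
  ultimately show ?thesis
    using M lattice_axioms unfolding supersolvable_lattice_def by blast
qed

end
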